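(* Fix $\mu>0$ and let $\mathbb{E}Q_\lambda(s)$ denote the expected steady-state queue length of the $M/M/s$ queue with arrival rate $\lambda$ and service rate $\mu$ (defined for all real $s>\lambda/\mu$). Suppose that for all $\sigma>0$ $$\mathbb{E}Q_\lambda\left(\frac{\lambda}{\mu}+\sigma\sqrt{\frac{\lambda}{\mu}}\right)=q(\sigma)\sqrt{\frac{\lambda}{\mu}}+\epsilon_\lambda(\sigma),$$ where $q$ is a thrice continuously differentiable non-negative function on $(0,\infty)$ and, for every $\sigma>0$, $\epsilon_\lambda(\sigma)=\mathcal{O}(1)$ as $\lambda\to\infty$. Then for any $\sigma>0$ and any $\delta_\lambda$ with $\delta_\lambda=\mathcal{O}(\lambda^{1/4})$ as $\lambda\to\infty$, $$\lim_{\lambda\to\infty}\left|\epsilon_\lambda(\sigma)-\epsilon_\lambda\left(\sigma+\frac{\delta_\lambda}{\sqrt{\lambda/\mu}}\right)\right|=0.$$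
   Context: For the $M/M/s$ queue with arrival rate $\lambda$, service rate $\mu$ per server and utilization $\rho=\lambda/(s\mu)<1$, $$\mathbb{E}Q_\lambda(s)=\frac{\lambda}{s\mu-\lambda}\,B(\rho,s),\qquad B(\rho,s)=\left[s\rho\int_0^\infty t\,e^{-s\rho t}(1+t)^{s-1}\,dt\right]^{-1},$$ for all real $s>\lambda/\mu$; for integer $s$, $B(\rho,s)$ is the Erlang-C probability that all servers are busy and $\mathbb{E}Q_\lambda(s)$ is the expected steady-state number of waiting customers. Notation: $f(\lambda)=\mathcal{O}(g(\lambda))$ means $\limsup_{\lambda\to\infty}|f(\lambda)|/g(\lambda)<\infty$. *)

theory Defs
  imports "HOL-Analysis.Analysis" "HOL-Library.Landau_Symbols"
begin

text \<open>
  The M/M/s queue with arrival rate \<open>lam\<close> and service rate \<open>\<mu>\<close> per server, extended to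
  real \<open>s\<close>: for a positive integer \<open>s\<close>, \<open>delay_prob \<rho> s\<close> is the Erlang-C probability that
  all servers are busy at utilization \<open>\<rho> < 1\<close>, and \<open>mean_queue \<mu> lam s\<close> is the expected
  steady-state number of waiting customers. The values are meaningful for \<open>lam > 0\<close> and
  \<open>s > lam / \<mu>\<close>, where the integral converges and is positive.
\<close>

definition delay_prob :: "real \<Rightarrow> real \<Rightarrow> real" where
  "delay_prob \<rho> s =
     inverse (s * \<rho> * (LBINT t:{0<..}. t * exp (- (s * \<rho> * t)) * (1 + t) powr (s - 1)))"

definition mean_queue :: "real \<Rightarrow> real \<Rightarrow> real \<Rightarrow> real" where
  "mean_queue \<mu> lam s = lam / (s * \<mu> - lam) * delay_prob (lam / (s * \<mu>)) s"

text \<open>Intended for open sets \<open>S\<close>, as the derivatives are two-sided.\<close>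

definition times_continuously_differentiable_on ::
    "nat \<Rightarrow> (real \<Rightarrow> real) \<Rightarrow> real set \<Rightarrow> bool" where
  "times_continuously_differentiable_on n f S \<longleftrightarrow>
     (\<forall>k<n. \<forall>x\<in>S. (deriv ^^ k) f field_differentiable at x) \<and>
     (\<forall>k\<le>n. continuous_on S ((deriv ^^ k) f))"

end

theory Submission
  imports Defs
begin

text \<open>
  Write \<open>R = lam / \<mu>\<close> for the offered load and \<open>x = 1 / sqrt R\<close>. Substituting \<open>t = x * u\<close>
  in the integral of the delay probability turns the mean queue length at
  \<open>R + s * sqrt R\<close> servers into \<open>sqrt R / (s * J x s)\<close>, where \<open>J x s\<close>, formally \<open>queue_integral x s\<close>, integrates
  \<open>u * exp (base_exponent x u + s * tilt x u)\<close> over the positive half-line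
  (\<open>mean_queue_eq_queue_integral\<close>). Both parts of the exponent converge as \<open>x\<close> tends to \<open>0\<close>,
  to \<open>- u^2 / 2\<close> and to \<open>u\<close>, so \<open>J\<close> extends to \<open>x = 0\<close> as a Gaussian integral.
  
  Since \<open>\<epsilon> lam s\<close> is bounded in \<open>lam\<close>, dividing the assumed expansion by \<open>sqrt R\<close> forces
  \<open>q s = 1 / (s * J 0 s)\<close>. The error term is therefore no longer arbitrary:
  \<open>\<epsilon> lam s = (1 / (s * J x s) - 1 / (s * J 0 s)) / x\<close>, which equals
  \<open>- ((J x s - J 0 s) / x) / (s * J x s * J 0 s)\<close>. It suffices to see that this quantity varies
  little with \<open>s\<close>, uniformly in \<open>x\<close>. The denominator tends to the positive number
  \<open>s * (J 0 s)^2\<close>, even when \<open>s\<close> moves with \<open>x\<close>. The scaled difference in the numerator is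
  bounded and Lipschitz in \<open>s\<close>, with constants that do not depend on \<open>x\<close>
  (\<open>queue_integral_diff_le\<close>, \<open>queue_integral_diff_lipschitz\<close>): the integrand and its
  \<open>s\<close>-derivative differ from their limits by at most \<open>x\<close> times an exponentially decaying
  function of \<open>u\<close>. As \<open>\<delta> lam / sqrt R\<close> tends to \<open>0\<close>, so does the change of the error.
\<close>

section \<open>Bounds for the logarithm\<close>

lemma ln_add_one_ge_quadratic:
  fixes y :: real
  assumes "y \<ge> 0"
  shows "y - y^2 / 2 \<le> ln (1 + y)"
proof -
  have "ln (1 + 0) - (0 - 0^2 / 2) \<le> ln (1 + y) - (y - y^2 / 2)"
  proof (rule DERIV_nonneg_imp_nondecreasing[OF assms])
    fix t :: real assume t: "0 \<le> t" "t \<le> y"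
    have "((\<lambda>y. ln (1 + y) - (y - y^2 / 2)) has_real_derivative (t^2 / (1 + t))) (at t)"
      using t by (auto intro!: derivative_eq_intros simp: field_simps power2_eq_square)
    moreover have "t^2 / (1 + t) \<ge> 0" using t by simp
    ultimately show "\<exists>d. ((\<lambda>y. ln (1 + y) - (y - y^2 / 2)) has_real_derivative d) (at t) \<and> d \<ge> 0"
      by blast
  qed
  then show ?thesis by simp
qed

lemma ln_add_one_le_cubic:
  fixes y :: real
  assumes "y \<ge> 0"
  shows "ln (1 + y) \<le> y - y^2 / 2 + y^3 / 3"
proof -
  have "(0 - 0^2 / 2 + 0^3 / 3) - ln (1 + 0) \<le> (y - y^2 / 2 + y^3 / 3) - ln (1 + y)"
  proof (rule DERIV_nonneg_imp_nondecreasing[OF assms])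
    fix t :: real assume t: "0 \<le> t" "t \<le> y"
    have "((\<lambda>y. (y - y^2 / 2 + y^3 / 3) - ln (1 + y)) has_real_derivative (t^3 / (1 + t))) (at t)"
      using t by (auto intro!: derivative_eq_intros simp: field_simps power2_eq_square power3_eq_cube)
    moreover have "t^3 / (1 + t) \<ge> 0" using t by simp
    ultimately show "\<exists>d. ((\<lambda>y. (y - y^2 / 2 + y^3 / 3) - ln (1 + y)) has_real_derivative d) (at t) \<and> d \<ge> 0"
      by blast
  qed
  then show ?thesis by simp
qed

text \<open>
  The cubic bound grows too fast to control the integrands for large arguments; here the
  subtracted term grows linearly, which is what gives them an exponential tail.
\<close>

lemma ln_add_one_le_rational:
  fixes y :: real
  assumes "y \<ge> 0"
  shows "ln (1 + y) \<le> y - y^2 / (2 * (1 + y))"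
proof -
  \<comment> \<open>The right-hand side equals \<open>(y + 1 - 1 / (1 + y)) / 2\<close>, which is easier to differentiate.\<close>
  have "(0 + 1 - inverse (1 + 0)) / 2 - ln (1 + 0) \<le> (y + 1 - inverse (1 + y)) / 2 - ln (1 + y)"
  proof (rule DERIV_nonneg_imp_nondecreasing[OF assms])
    fix t :: real assume t: "0 \<le> t" "t \<le> y"
    have "((\<lambda>y. (y + 1 - inverse (1 + y)) / 2 - ln (1 + y)) has_real_derivative
            (1 + inverse (1 + t) * inverse (1 + t)) / 2 - inverse (1 + t)) (at t)"
      using t by (auto intro!: derivative_eq_intros simp: add_divide_distrib inverse_eq_divide)
    moreover have "(1 + inverse (1 + t) * inverse (1 + t)) / 2 - inverse (1 + t)
                     = t^2 / (2 * (1 + t)^2)"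
      using t by (simp add: divide_simps) (simp add: algebra_simps power2_eq_square)
    ultimately have "((\<lambda>y. (y + 1 - inverse (1 + y)) / 2 - ln (1 + y)) has_real_derivative t^2 / (2 * (1 + t)^2)) (at t)"
      by simp
    moreover have "t^2 / (2 * (1 + t)^2) \<ge> 0" by simp
    ultimately show "\<exists>d. ((\<lambda>y. (y + 1 - inverse (1 + y)) / 2 - ln (1 + y)) has_real_derivative d) (at t) \<and> d \<ge> 0"
      by blast
  qed
  moreover have "(y + 1 - inverse (1 + y)) / 2 = y - y^2 / (2 * (1 + y))"
    using assms by (simp add: divide_simps) (simp add: algebra_simps power2_eq_square)
  ultimately show ?thesis by simp
qed

section \<open>The rescaled integrand\<close>

text \<open>
  With \<open>t = x * u\<close>, \<open>R = 1 / x^2\<close> and \<open>N = R + s / x\<close>, the logarithm of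
  \<open>exp (- R * t) * (1 + t) powr (N - 1)\<close> is affine in \<open>s\<close>, with slope \<open>tilt x u\<close> and
  constant term \<open>base_exponent x u\<close>. The values at \<open>x = 0\<close> are the limits, so that the
  diffusion limit is the member \<open>x = 0\<close> of one family and shares its bounds.
\<close>

definition tilt :: "real \<Rightarrow> real \<Rightarrow> real" where
  "tilt x u = (if x = 0 then u else ln (1 + x * u) / x)"

definition base_exponent :: "real \<Rightarrow> real \<Rightarrow> real" where
  "base_exponent x u =
     (if x = 0 then - (u^2 / 2) else (ln (1 + x * u) - x * u) / x^2 - ln (1 + x * u))"

definition weight :: "real \<Rightarrow> real \<Rightarrow> real \<Rightarrow> real" where
  "weight x s u = exp (base_exponent x u + s * tilt x u)"

definition queue_integral :: "real \<Rightarrow> real \<Rightarrow> real" where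
  "queue_integral x s = (LBINT u:{0<..}. u * weight x s u)"

lemma weight_measurable [measurable]: "weight x s \<in> borel_measurable borel"
  unfolding weight_def base_exponent_def tilt_def by (cases "x = 0") simp_all

lemma tilt_bounds:
  assumes "x \<ge> 0" "u \<ge> 0"
  shows "0 \<le> tilt x u" "tilt x u \<le> u" "\<bar>tilt x u - u\<bar> \<le> x * u^2 / 2"
proof -
  have "0 \<le> tilt x u \<and> tilt x u \<le> u \<and> u - x * u^2 / 2 \<le> tilt x u"
  proof (cases "x = 0")
    case False
    with assms have x: "x > 0" by simp
    have xu: "x * u \<ge> 0" using assms by simp
    have "0 \<le> ln (1 + x * u)" "ln (1 + x * u) \<le> x * u"
      using xu by (auto intro: ln_add_one_self_le_self)
    moreover have "x * u - (x * u)^2 / 2 \<le> ln (1 + x * u)"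
      by (rule ln_add_one_ge_quadratic[OF xu])
    moreover have "x * u - (x * u)^2 / 2 = (u - x * u^2 / 2) * x"
      by (simp add: algebra_simps power2_eq_square)
    ultimately show ?thesis using x
      by (simp add: tilt_def le_divide_eq divide_le_eq mult.commute[of u x])
  qed (use assms in \<open>simp add: tilt_def\<close>)
  then show "0 \<le> tilt x u" "tilt x u \<le> u" "\<bar>tilt x u - u\<bar> \<le> x * u^2 / 2"
    by linarith+
qed

lemma base_exponent_approx:
  assumes "x \<ge> 0" "u \<ge> 0"
  shows "\<bar>base_exponent x u + u^2 / 2\<bar> \<le> x * (u^3 / 3 + u)"
proof (cases "x = 0")
  case True
  then show ?thesis by (simp add: base_exponent_def)
next
  case False
  with assms have x: "x > 0" by simp
  have xu: "x * u \<ge> 0" using assms by simp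
  define c where "c = (ln (1 + x * u) - x * u) / x^2"
  have ln: "0 \<le> ln (1 + x * u)" "ln (1 + x * u) \<le> x * u"
    using xu by (auto intro: ln_add_one_self_le_self)
  have "- (u^2 / 2) * x^2 \<le> ln (1 + x * u) - x * u"
    using ln_add_one_ge_quadratic[OF xu] by (simp add: algebra_simps)
  then have lo: "- (u^2 / 2) \<le> c"
    unfolding c_def using x by (subst le_divide_eq) auto
  have "ln (1 + x * u) - x * u \<le> (- (u^2 / 2) + x * (u^3 / 3)) * x^2"
    using ln_add_one_le_cubic[OF xu]
    by (simp add: algebra_simps power2_eq_square power3_eq_cube)
  then have hi: "c \<le> - (u^2 / 2) + x * (u^3 / 3)"
    unfolding c_def using x by (subst divide_le_eq) auto
  have "base_exponent x u = c - ln (1 + x * u)"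
    using x by (simp add: base_exponent_def c_def)
  moreover have "0 \<le> x * (u^3 / 3)" using assms by simp
  ultimately show ?thesis using lo hi ln by (simp add: distrib_left)
qed

text \<open>
  The slope \<open>m\<close> of the decay can be prescribed, at the price of restricting \<open>x\<close>: for fixed
  \<open>x > 0\<close> the exponential of the exponent decays only like \<open>exp (- u / x)\<close> up to powers of \<open>u\<close>,
  and this decay must later beat the growth \<open>exp (s * u)\<close> of the tilting factor.
\<close>

lemma base_exponent_linear_bound:
  assumes "m > 0" "0 \<le> x" "x \<le> 1 / (2 * m)" "u \<ge> 0"
  shows "base_exponent x u \<le> 2 * m^2 - m * u"
proof -
  \<comment> \<open>As \<open>x \<le> 1 / (2 * m)\<close>, this reduces to \<open>(m * u - 2 * m^2) * (1 + u / (2 * m)) \<le> u^2 / 2\<close>,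
    whose two sides differ by the constant \<open>2 * m^2\<close>.\<close>
  have lin: "m * u - 2 * m^2 \<le> u^2 / (2 * (1 + x * u))"
  proof -
    have "(m * u - 2 * m^2) * (1 + u / (2 * m)) = u^2 / 2 - 2 * m^2"
      using assms by (simp add: field_simps power2_eq_square)
    then have "(m * u - 2 * m^2) * (1 + u / (2 * m)) \<le> u^2 / 2" by simp
    moreover have "1 + u / (2 * m) > 0" using assms by (simp add: add_pos_nonneg)
    ultimately have "m * u - 2 * m^2 \<le> (u^2 / 2) / (1 + u / (2 * m))"
      by (subst le_divide_eq) auto
    also have "\<dots> \<le> (u^2 / 2) / (1 + x * u)"
    proof (rule divide_left_mono)
      show "1 + x * u \<le> 1 + u / (2 * m)"
        using mult_right_mono[OF assms(3,4)] by simp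
      show "0 < (1 + u / (2 * m)) * (1 + x * u)"
        using assms by (intro mult_pos_pos add_pos_nonneg) auto
    qed simp
    finally show ?thesis by simp
  qed
  show ?thesis
  proof (cases "x = 0")
    case True
    with lin show ?thesis by (simp add: base_exponent_def)
  next
    case False
    with assms have x: "x > 0" by simp
    have xu: "x * u \<ge> 0" using assms by simp
    have "ln (1 + x * u) - x * u \<le> - (u^2 / (2 * (1 + x * u))) * x^2"
      using ln_add_one_le_rational[OF xu] by (simp add: power_mult_distrib mult.commute)
    then have "(ln (1 + x * u) - x * u) / x^2 \<le> - (u^2 / (2 * (1 + x * u)))"
      using x by (subst divide_le_eq) auto
    moreover have "0 \<le> ln (1 + x * u)" using xu by simp
    ultimately show ?thesis using lin x by (simp add: base_exponent_def)
  qed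
qed

section \<open>Exponential domination\<close>

lemma abs_exp_diff_le:
  fixes a b :: real
  assumes "a \<le> M" "b \<le> M"
  shows "\<bar>exp a - exp b\<bar> \<le> \<bar>a - b\<bar> * exp M"
proof -
  have *: "exp a - exp b \<le> (a - b) * exp M" if "b \<le> a" "a \<le> M" for a b :: real
  proof -
    have "exp a - exp b = exp a * (1 - exp (b - a))"
      by (simp add: right_diff_distrib flip: exp_add)
    also have "\<dots> \<le> exp a * (a - b)"
      using exp_ge_add_one_self[of "b - a"] by (intro mult_left_mono) (linarith, simp)
    also have "\<dots> \<le> exp M * (a - b)" using that by (intro mult_right_mono) auto
    finally show ?thesis by (simp add: mult.commute)
  qed
  show ?thesis
    using *[of a b] *[of b a] assms by (cases "a \<le> b") (auto simp: abs_if)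
qed

text \<open>
  This trades powers of \<open>u\<close> for exponential factors, so that all dominating functions below
  are multiples of a single exponential.
\<close>

lemma power_le_exp:
  fixes u :: real
  assumes "u \<ge> 0" "k \<le> n"
  shows "u ^ k \<le> exp (real n * u)"
proof -
  have "u \<le> exp u" using exp_ge_add_one_self[of u] by linarith
  then have "u ^ k \<le> exp u ^ k" using assms by (intro power_mono) auto
  also have "\<dots> = exp (real k * u)" by (simp add: exp_of_nat_mult)
  also have "\<dots> \<le> exp (real n * u)" using assms by (simp add: mult_right_mono)
  finally show ?thesis .
qed

lemma set_integrable_exp_minus:
  "set_integrable lborel {0<..} (\<lambda>u::real. exp (- u))"
  "(LBINT u:{0<..}. exp (- u)) \<le> (1::real)"
proof -
  have hi: "((\<lambda>u::real. exp (- u)) has_integral 1) {0..}"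
    using has_integral_exp_minus_to_infinity[of 1 0] by simp
  then have "(\<lambda>u::real. exp (- u)) absolutely_integrable_on {0..}"
    by (intro nonnegative_absolutely_integrable_1) (auto simp: integrable_on_def)
  then have int: "set_integrable lborel {0..} (\<lambda>u::real. exp (- u))"
    unfolding set_integrable_def by (subst (asm) integrable_completion) auto
  show int': "set_integrable lborel {0<..} (\<lambda>u::real. exp (- u))"
    by (rule set_integrable_subset[OF int]) auto
  have "(LBINT u:{0<..}. exp (- u)) \<le> (LBINT u:{0..}. exp (- u :: real))"
    unfolding set_lebesgue_integral_def
    using int int' unfolding set_integrable_def
    by (intro integral_mono) (auto simp: indicator_def)
  also have "\<dots> = 1"
    using set_borel_integral_eq_integral(2)[OF int] hi by (simp add: integral_unique)
  finally show "(LBINT u:{0<..}. exp (- u)) \<le> (1::real)" .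
qed

lemma exponential_domination:
  fixes f :: "real \<Rightarrow> real"
  assumes [measurable]: "f \<in> borel_measurable borel"
    and bound: "\<And>u. u > 0 \<Longrightarrow> \<bar>f u\<bar> \<le> K * exp (- u)"
  shows "set_integrable lborel {0<..} f" "\<bar>LBINT u:{0<..}. f u\<bar> \<le> K"
proof -
  have K: "K \<ge> 0"
  proof -
    have "0 \<le> K * exp (- 1)" using bound[of 1] by linarith
    then show ?thesis by (simp add: zero_le_mult_iff)
  qed
  have intK: "set_integrable lborel {0<..} (\<lambda>u. K * exp (- u))"
    by (intro set_integrable_mult_right set_integrable_exp_minus)
  show int: "set_integrable lborel {0<..} f"
  proof (rule set_integrable_bound[OF intK])
    show "set_borel_measurable lborel {0<..} f" unfolding set_borel_measurable_def by simp
    show "AE u in lborel. u \<in> {0<..} \<longrightarrow> norm (f u) \<le> norm (K * exp (- u))"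
      using bound K by (auto simp: abs_mult)
  qed
  have "\<bar>LBINT u:{0<..}. f u\<bar> \<le> (LBINT u:{0<..}. \<bar>f u\<bar>)"
    using set_integral_norm_bound[OF int] by simp
  also have "\<dots> \<le> (LBINT u:{0<..}. K * exp (- u))"
    using bound by (intro set_integral_mono set_integrable_abs int intK) auto
  also have "\<dots> = K * (LBINT u:{0<..}. exp (- u))" by simp
  also have "\<dots> \<le> K * 1" using K set_integrable_exp_minus(2) by (intro mult_left_mono)
  finally show "\<bar>LBINT u:{0<..}. f u\<bar> \<le> K" by simp
qed

section \<open>Rate of convergence of the integral\<close>

text \<open>
  All estimates are uniform over the offsets \<open>s\<close> in \<open>[0, S]\<close>. The number \<open>6\<close> is the decay rate
  of \<open>weight\<close> that remains after tilting: in the estimates below, five factors \<open>exp u\<close> absorb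
  powers of \<open>u\<close> up to the fifth, which arise from the weight \<open>u\<close>, the derivative in \<open>s\<close> (another
  factor \<open>u\<close>) and the cubic error of the exponent; one factor remains for integrability.
\<close>

context
  fixes S C x0 :: real
  assumes S: "S > 0"
  defines "x0 \<equiv> 1 / (2 * (S + 6))"
    and "C \<equiv> exp (2 * (S + 6)^2)"
begin

lemma exponent_bound:
  assumes "0 \<le> x" "x \<le> x0" "0 \<le> s" "s \<le> S" "u \<ge> 0"
  shows "base_exponent x u + s * tilt x u \<le> 2 * (S + 6)^2 - 6 * u"
proof -
  have "base_exponent x u \<le> 2 * (S + 6)^2 - (S + 6) * u"
    using S assms by (intro base_exponent_linear_bound) (auto simp: x0_def)
  moreover have "s * tilt x u \<le> S * u"
    using assms tilt_bounds[of x u] by (intro mult_mono) auto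
  ultimately show ?thesis by (simp add: algebra_simps)
qed

lemma weight_le:
  assumes "0 \<le> x" "x \<le> x0" "0 \<le> s" "s \<le> S" "u \<ge> 0"
  shows "weight x s u \<le> C * exp (- (6 * u))"
  using exponent_bound[OF assms] unfolding weight_def C_def by (simp flip: exp_add)

lemma weight_diff_le:
  assumes "0 \<le> x" "x \<le> x0" "0 \<le> s" "s \<le> S" "u \<ge> 0"
  shows "\<bar>weight x s u - weight 0 s u\<bar> \<le> x * ((S + 2) * C) * exp (- (3 * u))"
proof -
  have x0: "0 \<le> x0" using S by (simp add: x0_def)
  define d where "d = (base_exponent x u + s * tilt x u) - (base_exponent 0 u + s * tilt 0 u)"
  have "d = (base_exponent x u + u^2 / 2) + s * (tilt x u - u)"
    by (simp add: d_def base_exponent_def[of 0] tilt_def[of 0] algebra_simps)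
  also have "\<bar>\<dots>\<bar> \<le> x * (u^3 / 3 + u) + S * (x * u^2 / 2)"
  proof (rule order_trans[OF abs_triangle_ineq add_mono])
    show "\<bar>base_exponent x u + u^2 / 2\<bar> \<le> x * (u^3 / 3 + u)"
      using assms by (intro base_exponent_approx) auto
    show "\<bar>s * (tilt x u - u)\<bar> \<le> S * (x * u^2 / 2)"
      unfolding abs_mult using assms tilt_bounds(3)[of x u] by (intro mult_mono) auto
  qed
  also have "\<dots> = x * (u^3 / 3 + u + S * (u^2 / 2))" by (simp add: algebra_simps)
  also have "\<dots> \<le> x * (exp (3 * u) + exp (3 * u) + S * exp (3 * u))"
  proof (intro mult_left_mono add_mono)
    show "u^3 / 3 \<le> exp (3 * u)" "u \<le> exp (3 * u)" "u^2 / 2 \<le> exp (3 * u)"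
      using power_le_exp[of u 3 3] power_le_exp[of u 1 3] power_le_exp[of u 2 3] assms by auto
  qed (use assms S in auto)
  finally have d: "\<bar>d\<bar> \<le> x * (S + 2) * exp (3 * u)" by (simp add: algebra_simps)
  have "\<bar>weight x s u - weight 0 s u\<bar> \<le> \<bar>d\<bar> * exp (2 * (S + 6)^2 - 6 * u)"
    unfolding weight_def d_def
    using assms x0 by (intro abs_exp_diff_le exponent_bound) auto
  also have "\<dots> \<le> (x * (S + 2) * exp (3 * u)) * exp (2 * (S + 6)^2 - 6 * u)"
    using d by (intro mult_right_mono) auto
  also have "\<dots> = x * ((S + 2) * C) * exp (- (3 * u))"
    by (simp add: C_def flip: exp_add)
  finally show ?thesis .
qed

lemma weight_has_derivative:
  "((\<lambda>s. weight x s u) has_real_derivative (tilt x u * weight x s u)) (at s within A)"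
  unfolding weight_def by (auto intro!: derivative_eq_intros)

text \<open>
  The derivative in \<open>s\<close> of \<open>weight x s u\<close> is \<open>tilt x u * weight x s u\<close>. Both factors are
  within \<open>O(x)\<close> of their limits, hence so is the product, and the mean value theorem keeps the
  factor \<open>x\<close> next to \<open>\<bar>s - t\<bar>\<close>.
\<close>

lemma weight_diff_lipschitz:
  assumes "0 \<le> x" "x \<le> x0" "s \<in> {0..S}" "t \<in> {0..S}" "u \<ge> 0"
  shows "\<bar>(weight x s u - weight 0 s u) - (weight x t u - weight 0 t u)\<bar>
           \<le> x * ((S + 3) * C) * exp (- (2 * u)) * \<bar>s - t\<bar>"
proof -
  have x0: "0 \<le> x0" using S by (simp add: x0_def)
  have C: "C > 0" by (simp add: C_def)
  have "norm ((weight x s u - weight 0 s u) - (weight x t u - weight 0 t u))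
          \<le> (x * ((S + 3) * C) * exp (- (2 * u))) * norm (s - t)"
  proof (rule field_differentiable_bound[of "{0..S}"])
    fix r assume r: "r \<in> {0..S}"
    show "((\<lambda>s. weight x s u - weight 0 s u) has_real_derivative
            (tilt x u * weight x r u - tilt 0 u * weight 0 r u)) (at r within {0..S})"
      by (intro DERIV_diff weight_has_derivative)
    have "tilt x u * weight x r u - tilt 0 u * weight 0 r u
            = (tilt x u - u) * weight x r u + u * (weight x r u - weight 0 r u)"
      by (simp add: tilt_def[of 0] algebra_simps)
    also have "\<bar>\<dots>\<bar> \<le> (x * exp (4 * u)) * (C * exp (- (6 * u)))
                     + exp u * (x * ((S + 2) * C) * exp (- (3 * u)))"
    proof (rule order_trans[OF abs_triangle_ineq add_mono])
      have "u^2 \<le> exp (4 * u)" using power_le_exp[of u 2 4] assms by simp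
      then have sq: "u^2 / 2 \<le> exp (4 * u)" using exp_gt_zero[of "4 * u"] by linarith
      have "\<bar>tilt x u - u\<bar> \<le> x * (u^2 / 2)" using tilt_bounds(3)[of x u] assms by simp
      also have "\<dots> \<le> x * exp (4 * u)"
        using sq assms by (intro mult_left_mono) auto
      finally show "\<bar>(tilt x u - u) * weight x r u\<bar> \<le> (x * exp (4 * u)) * (C * exp (- (6 * u)))"
        unfolding abs_mult using weight_le[of x r u] assms r C
        by (intro mult_mono) (auto simp: weight_def)
      show "\<bar>u * (weight x r u - weight 0 r u)\<bar> \<le> exp u * (x * ((S + 2) * C) * exp (- (3 * u)))"
        unfolding abs_mult using weight_diff_le[of x r u] power_le_exp[of u 1 1] assms r
        by (intro mult_mono) auto
    qed
    also have "\<dots> = x * ((S + 3) * C) * exp (- (2 * u))"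
      by (simp add: algebra_simps flip: exp_add)
    finally show "norm (tilt x u * weight x r u - tilt 0 u * weight 0 r u)
                    \<le> x * ((S + 3) * C) * exp (- (2 * u))" by simp
  qed (use assms in auto)
  then show ?thesis by simp
qed

lemma weight_limit_lipschitz:
  assumes "s \<in> {0..S}" "t \<in> {0..S}" "u \<ge> 0"
  shows "\<bar>weight 0 s u - weight 0 t u\<bar> \<le> C * exp (- (5 * u)) * \<bar>s - t\<bar>"
proof -
  have x0: "0 \<le> x0" using S by (simp add: x0_def)
  have C: "C > 0" by (simp add: C_def)
  have "norm (weight 0 s u - weight 0 t u) \<le> (C * exp (- (5 * u))) * norm (s - t)"
  proof (rule field_differentiable_bound[of "{0..S}"])
    fix r assume r: "r \<in> {0..S}"
    show "((\<lambda>s. weight 0 s u) has_real_derivative (tilt 0 u * weight 0 r u)) (at r within {0..S})"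
      by (rule weight_has_derivative)
    have "\<bar>tilt 0 u * weight 0 r u\<bar> \<le> exp u * (C * exp (- (6 * u)))"
      unfolding abs_mult
      using weight_le[of 0 r u] power_le_exp[of u 1 1] assms r x0
      by (intro mult_mono) (auto simp: tilt_def weight_def)
    then show "norm (tilt 0 u * weight 0 r u) \<le> C * exp (- (5 * u))"
      by (simp add: algebra_simps flip: exp_add)
  qed (use assms in auto)
  then show ?thesis by simp
qed

lemma times_exp_bound:
  fixes f :: real
  assumes "\<bar>f\<bar> \<le> K * exp (- (k * u))" "k \<ge> 2" "u \<ge> 0"
  shows "\<bar>u * f\<bar> \<le> K * exp (- u)"
proof -
  have K: "K \<ge> 0"
    using order_trans[OF abs_ge_zero assms(1)] by (simp add: zero_le_mult_iff)
  have "\<bar>u * f\<bar> \<le> exp u * (K * exp (- (k * u)))"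
    unfolding abs_mult using assms power_le_exp[of u 1 1] by (intro mult_mono) auto
  also have "\<dots> = K * exp (u - k * u)" by (simp add: exp_diff exp_minus field_simps)
  also have "\<dots> \<le> K * exp (- u)"
    using K mult_right_mono[OF assms(2,3)] by (intro mult_left_mono) auto
  finally show ?thesis .
qed

lemma queue_integrand_integrable:
  assumes "0 \<le> x" "x \<le> x0" "s \<in> {0..S}"
  shows "set_integrable lborel {0<..} (\<lambda>u. u * weight x s u)"
  by (rule exponential_domination(1)[where K = C], simp, rule times_exp_bound[where k = 6])
    (use weight_le[of x s] assms in \<open>auto simp: weight_def\<close>)

lemma queue_integral_diff_le:
  assumes "0 \<le> x" "x \<le> x0" "s \<in> {0..S}"
  shows "\<bar>queue_integral x s - queue_integral 0 s\<bar> \<le> x * ((S + 2) * C)"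
proof -
  have x0: "0 \<le> x0" using S by (simp add: x0_def)
  have "queue_integral x s - queue_integral 0 s
          = (LBINT u:{0<..}. u * weight x s u - u * weight 0 s u)"
    unfolding queue_integral_def using assms x0
    by (intro set_integral_diff(2)[symmetric] queue_integrand_integrable) auto
  also have "\<bar>\<dots>\<bar> \<le> x * ((S + 2) * C)"
  proof (rule exponential_domination(2))
    fix u :: real assume "u > 0"
    then show "\<bar>u * weight x s u - u * weight 0 s u\<bar> \<le> x * ((S + 2) * C) * exp (- u)"
      unfolding right_diff_distrib[symmetric]
      using weight_diff_le[of x s u] assms by (intro times_exp_bound[where k = 3]) auto
  qed simp
  finally show ?thesis .
qed

text \<open>
  The factor \<open>x\<close> matters: it survives the division by \<open>x\<close> that defines the scaled error, so
  moving \<open>s\<close> by a vanishing amount changes that error by a vanishing amount.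
\<close>

lemma queue_integral_diff_lipschitz:
  assumes "0 \<le> x" "x \<le> x0" "s \<in> {0..S}" "t \<in> {0..S}"
  shows "\<bar>(queue_integral x s - queue_integral 0 s) - (queue_integral x t - queue_integral 0 t)\<bar>
           \<le> x * ((S + 3) * C) * \<bar>s - t\<bar>"
proof -
  have x0: "0 \<le> x0" using S by (simp add: x0_def)
  note int = queue_integrand_integrable
  have "(queue_integral x s - queue_integral 0 s) - (queue_integral x t - queue_integral 0 t)
          = (LBINT u:{0<..}. (u * weight x s u - u * weight 0 s u)
                             - (u * weight x t u - u * weight 0 t u))"
    unfolding queue_integral_def using assms x0 by (simp add: int)
  also have "\<bar>\<dots>\<bar> \<le> x * ((S + 3) * C) * \<bar>s - t\<bar>"
  proof (rule exponential_domination(2))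
    fix u :: real assume "u > 0"
    then have "\<bar>(weight x s u - weight 0 s u) - (weight x t u - weight 0 t u)\<bar>
                 \<le> x * ((S + 3) * C) * \<bar>s - t\<bar> * exp (- (2 * u))"
      using weight_diff_lipschitz[of x s t u] assms by (simp add: mult_ac)
    then show "\<bar>(u * weight x s u - u * weight 0 s u) - (u * weight x t u - u * weight 0 t u)\<bar>
                 \<le> x * ((S + 3) * C) * \<bar>s - t\<bar> * exp (- u)"
      unfolding right_diff_distrib[symmetric]
      using \<open>u > 0\<close> by (intro times_exp_bound[where k = 2]) auto
  qed simp
  finally show ?thesis .
qed

lemma queue_integral_limit_lipschitz:
  assumes "s \<in> {0..S}" "t \<in> {0..S}"
  shows "\<bar>queue_integral 0 s - queue_integral 0 t\<bar> \<le> C * \<bar>s - t\<bar>"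
proof -
  have x0: "0 \<le> x0" using S by (simp add: x0_def)
  have "queue_integral 0 s - queue_integral 0 t
          = (LBINT u:{0<..}. u * weight 0 s u - u * weight 0 t u)"
    unfolding queue_integral_def using assms x0
    by (intro set_integral_diff(2)[symmetric] queue_integrand_integrable) auto
  also have "\<bar>\<dots>\<bar> \<le> C * \<bar>s - t\<bar>"
  proof (rule exponential_domination(2))
    fix u :: real assume "u > 0"
    then have "\<bar>weight 0 s u - weight 0 t u\<bar> \<le> C * \<bar>s - t\<bar> * exp (- (5 * u))"
      using weight_limit_lipschitz[of s t u] assms by (simp add: mult_ac)
    then show "\<bar>u * weight 0 s u - u * weight 0 t u\<bar> \<le> C * \<bar>s - t\<bar> * exp (- u)"
      unfolding right_diff_distrib[symmetric]
      using \<open>u > 0\<close> by (intro times_exp_bound[where k = 5]) auto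
  qed simp
  finally show ?thesis .
qed

end

lemma queue_integral_limit_pos:
  assumes "s \<ge> 0"
  shows "queue_integral 0 s > 0"
proof -
  let ?f = "\<lambda>u. indicator {0<..} u *\<^sub>R (u * weight 0 s u)"
  have int: "integrable lborel ?f"
    using queue_integrand_integrable[of "s + 1" 0 s] assms by (simp add: set_integrable_def)
  have nonneg: "?f u \<ge> 0" for u by (simp add: indicator_def weight_def)
  \<comment> \<open>A vanishing integral would make the integrand vanish almost everywhere on the unit interval.\<close>
  have "\<not> (AE u in lborel. ?f u = 0)"
  proof
    assume "AE u in lborel. ?f u = 0"
    then have "AE u in lborel. u \<notin> {0<..<1::real}"
      by eventually_elim (auto simp: indicator_def weight_def split: if_splits)
    then have "{0<..<1::real} \<in> null_sets lborel"
      by (subst (asm) AE_iff_null_sets[symmetric]) auto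
    then show False by (auto simp: null_sets_def)
  qed
  then have "integral\<^sup>L lborel ?f \<noteq> 0"
    using integral_nonneg_eq_0_iff_AE[OF int] nonneg by auto
  moreover have "integral\<^sup>L lborel ?f \<ge> 0" using nonneg by (intro Bochner_Integration.integral_nonneg)
  ultimately show ?thesis by (simp add: queue_integral_def set_lebesgue_integral_def)
qed

section \<open>The mean queue length as an integral\<close>

text \<open>
  The offered load satisfies \<open>N * \<rho> = R\<close>, so the integral depends on \<open>N\<close> only through the
  exponent of \<open>1 + t\<close>. The substitution \<open>t = u / sqrt R\<close> yields a factor \<open>1 / R\<close>, which cancels
  the prefactor \<open>N * \<rho>\<close>.
\<close>

lemma mean_queue_eq_queue_integral:
  assumes "\<mu> > 0" "lam > 0" "s > 0"
  defines "R \<equiv> lam / \<mu>"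
  shows "mean_queue \<mu> lam (R + s * sqrt R) = sqrt R / (s * queue_integral (1 / sqrt R) s)"
proof -
  define n where "n = sqrt R"
  have n: "n > 0" using assms by (simp add: n_def)
  have R: "R = n^2" using assms by (simp add: n_def)
  have lam: "lam = n^2 * \<mu>" using R assms by (simp add: R_def field_simps)
  define N where "N = R + s * n"
  have N: "N > 0" using n assms(3) by (simp add: N_def R add_pos_pos)
  have load: "N * (lam / (N * \<mu>)) = n^2" using N assms by (simp add: lam)
  have integrand: "u / n * exp (- (n^2 * (u / n))) * (1 + u / n) powr (N - 1)
                     = u / n * weight (1 / n) s u" if "u > 0" for u
  proof -
    have "1 + u / n > 0" using n that by (simp add: add_pos_pos)
    then have "exp (- (n^2 * (u / n))) * (1 + u / n) powr (N - 1)
                 = exp (- (n^2 * (u / n)) + (N - 1) * ln (1 + u / n))"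
      by (simp add: powr_def flip: exp_add)
    also have "- (n^2 * (u / n)) + (N - 1) * ln (1 + u / n)
                 = base_exponent (1 / n) u + s * tilt (1 / n) u"
      using n by (simp add: base_exponent_def tilt_def N_def R field_simps power2_eq_square)
    finally show ?thesis by (simp add: weight_def)
  qed
  have "(LBINT t:{0<..}. t * exp (- (n^2 * t)) * (1 + t) powr (N - 1))
          = \<bar>1 / n\<bar> *\<^sub>R (\<integral>u. indicator {0<..} (0 + 1 / n * u) *\<^sub>R ((0 + 1 / n * u)
              * exp (- (n^2 * (0 + 1 / n * u))) * (1 + (0 + 1 / n * u)) powr (N - 1)) \<partial>lborel)"
    unfolding set_lebesgue_integral_def
    by (rule lborel_integral_real_affine) (use n in simp)
  also have "\<dots> = 1 / n * (\<integral>u. 1 / n * (indicator {0<..} u *\<^sub>R (u * weight (1 / n) s u)) \<partial>lborel)"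
    using n integrand
    by (auto simp: indicator_def zero_less_divide_iff intro!: Bochner_Integration.integral_cong)
  also have "\<dots> = queue_integral (1 / n) s / n^2"
    by (simp add: queue_integral_def set_lebesgue_integral_def power2_eq_square)
  finally have "delay_prob (lam / (N * \<mu>)) N = inverse (queue_integral (1 / n) s)"
    unfolding delay_prob_def load using n by simp
  moreover have "lam / (N * \<mu> - lam) = n / s"
    using n assms by (simp add: lam N_def R field_simps power2_eq_square)
  ultimately show ?thesis
    by (simp add: mean_queue_def n_def[symmetric] N_def[symmetric] divide_inverse)
qed

section \<open>The error of the square-root expansion\<close>

lemma queue_integral_tendsto:
  assumes x: "(x \<longlongrightarrow> 0) F" "eventually (\<lambda>a. x a \<ge> 0) F"
    and t: "(t \<longlongrightarrow> s) F" and s: "s > 0"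
  shows "((\<lambda>a. queue_integral (x a) (t a)) \<longlongrightarrow> queue_integral 0 s) F"
proof -
  define S where "S = s + 1"
  have S: "S > 0" using s by (simp add: S_def)
  have t_abs: "((\<lambda>a. \<bar>t a - s\<bar>) \<longlongrightarrow> 0) F"
    by (intro tendsto_rabs_zero LIM_zero t)
  define C where "C = exp (2 * (S + 6)^2)"
  have ev: "eventually (\<lambda>a. 0 \<le> x a \<and> x a \<le> 1 / (2 * (S + 6)) \<and> t a \<in> {0..S}) F"
  proof -
    have "eventually (\<lambda>a. x a < 1 / (2 * (S + 6))) F"
      using S by (intro order_tendstoD(2)[OF x(1)]) simp
    moreover have "eventually (\<lambda>a. 0 < t a) F" "eventually (\<lambda>a. t a < S) F"
      using order_tendstoD[OF t] s by (auto simp: S_def)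
    ultimately show ?thesis using x(2) by eventually_elim auto
  qed
  have "((\<lambda>a. queue_integral (x a) (t a) - queue_integral 0 s) \<longlongrightarrow> 0) F"
  proof (rule Lim_null_comparison)
    show "eventually (\<lambda>a. norm (queue_integral (x a) (t a) - queue_integral 0 s)
            \<le> x a * ((S + 2) * C) + C * \<bar>t a - s\<bar>) F"
      using ev
    proof eventually_elim
      case (elim a)
      have "\<bar>queue_integral (x a) (t a) - queue_integral 0 (t a)\<bar> \<le> x a * ((S + 2) * C)"
        using queue_integral_diff_le[OF S] elim by (auto simp: C_def)
      moreover have "\<bar>queue_integral 0 (t a) - queue_integral 0 s\<bar> \<le> C * \<bar>t a - s\<bar>"
        using queue_integral_limit_lipschitz[OF S] elim s by (auto simp: C_def S_def)
      ultimately show ?case by simp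
    qed
    show "((\<lambda>a. x a * ((S + 2) * C) + C * \<bar>t a - s\<bar>) \<longlongrightarrow> 0) F"
      using tendsto_add[OF tendsto_mult_left_zero[OF x(1), of "(S + 2) * C"]
          tendsto_mult_right_zero[OF t_abs, of C]] by simp
  qed
  then show ?thesis by (rule LIM_zero_cancel)
qed

text \<open>
  The mean queue length divided by \<open>sqrt R\<close> is \<open>1 / (s * queue_integral x s)\<close>, and \<open>x\<close> is
  \<open>1 / sqrt R\<close>. So this is the mean queue length minus \<open>sqrt R\<close> times the limiting coefficient.
\<close>

definition scaled_error :: "real \<Rightarrow> real \<Rightarrow> real" where
  "scaled_error x s = (1 / (s * queue_integral x s) - 1 / (s * queue_integral 0 s)) / x"

text \<open>
  On a common denominator the scaled error becomes \<open>- err / den\<close>, where \<open>err\<close> is bounded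
  and equicontinuous in \<open>s\<close> as \<open>x\<close> tends to \<open>0\<close>, and \<open>den\<close> has the same nonzero limit along
  \<open>s\<close> and along \<open>t\<close>. The increment splits into the change of \<open>err\<close> times a convergent
  factor, plus the bounded \<open>err\<close> times the vanishing change of \<open>1 / den\<close>.
\<close>

lemma scaled_error_increment_tendsto_0:
  assumes x: "(x \<longlongrightarrow> 0) F" "eventually (\<lambda>a. x a > 0) F"
    and t: "(t \<longlongrightarrow> s) F" and s: "s > 0"
  shows "((\<lambda>a. scaled_error (x a) s - scaled_error (x a) (t a)) \<longlongrightarrow> 0) F"
proof -
  define S where "S = s + 1"
  have S: "S > 0" using s by (simp add: S_def)
  have t_abs: "((\<lambda>a. \<bar>t a - s\<bar>) \<longlongrightarrow> 0) F"
    by (intro tendsto_rabs_zero LIM_zero t)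
  define C where "C = exp (2 * (S + 6)^2)"
  define err where "err y r = (queue_integral y r - queue_integral 0 r) / y" for y r
  define den where "den y r = r * queue_integral y r * queue_integral 0 r" for y r
  have J0: "queue_integral 0 s > 0" using queue_integral_limit_pos[of s] s by simp
  have x': "eventually (\<lambda>a. x a \<ge> 0) F" using x(2) by eventually_elim simp
  have Jt: "((\<lambda>a. queue_integral (x a) (t a)) \<longlongrightarrow> queue_integral 0 s) F"
    by (rule queue_integral_tendsto[OF x(1) x' t s])
  have Js: "((\<lambda>a. queue_integral (x a) s) \<longlongrightarrow> queue_integral 0 s) F"
    by (rule queue_integral_tendsto[OF x(1) x' tendsto_const s])
  have J0t: "((\<lambda>a. queue_integral 0 (t a)) \<longlongrightarrow> queue_integral 0 s) F"
    by (rule queue_integral_tendsto[OF tendsto_const _ t s]) simp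
  have "((\<lambda>a. 1 / den (x a) (t a) - 1 / den (x a) s)
           \<longlongrightarrow> 1 / den 0 s - 1 / den 0 s) F"
    unfolding den_def using J0 s by (intro tendsto_intros Jt Js J0t t) auto
  then have den: "((\<lambda>a. 1 / den (x a) (t a) - 1 / den (x a) s) \<longlongrightarrow> 0) F" by simp
  have dent: "((\<lambda>a. 1 / den (x a) (t a)) \<longlongrightarrow> 1 / den 0 s) F"
    unfolding den_def using J0 s by (intro tendsto_intros Jt J0t t) auto
  have ev: "eventually (\<lambda>a. 0 < x a \<and> x a \<le> 1 / (2 * (S + 6)) \<and> t a \<in> {0<..S}) F"
  proof -
    have "eventually (\<lambda>a. x a < 1 / (2 * (S + 6))) F"
      using S by (intro order_tendstoD(2)[OF x(1)]) simp
    moreover have "eventually (\<lambda>a. 0 < t a) F" "eventually (\<lambda>a. t a < S) F"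
      using order_tendstoD[OF t] s by (auto simp: S_def)
    ultimately show ?thesis using x(2) by eventually_elim auto
  qed
  have err_diff: "((\<lambda>a. err (x a) (t a) - err (x a) s) \<longlongrightarrow> 0) F"
  proof (rule Lim_null_comparison)
    show "eventually (\<lambda>a. norm (err (x a) (t a) - err (x a) s) \<le> (S + 3) * C * \<bar>t a - s\<bar>) F"
      using ev
    proof eventually_elim
      case (elim a)
      have "\<bar>(queue_integral (x a) (t a) - queue_integral 0 (t a))
              - (queue_integral (x a) s - queue_integral 0 s)\<bar>
              \<le> x a * ((S + 3) * C) * \<bar>t a - s\<bar>"
        using queue_integral_diff_lipschitz[OF S] elim s by (auto simp: C_def S_def)
      then show ?case
        using elim by (simp add: err_def divide_le_eq mult_ac flip: diff_divide_distrib)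
    qed
    show "((\<lambda>a. (S + 3) * C * \<bar>t a - s\<bar>) \<longlongrightarrow> 0) F"
      by (intro tendsto_mult_right_zero t_abs)
  qed
  have err_den: "((\<lambda>a. err (x a) s * (1 / den (x a) (t a) - 1 / den (x a) s)) \<longlongrightarrow> 0) F"
  proof (rule Lim_null_comparison)
    show "eventually (\<lambda>a. norm (err (x a) s * (1 / den (x a) (t a) - 1 / den (x a) s))
            \<le> (S + 2) * C * \<bar>1 / den (x a) (t a) - 1 / den (x a) s\<bar>) F"
      using ev
    proof eventually_elim
      case (elim a)
      have "\<bar>queue_integral (x a) s - queue_integral 0 s\<bar> \<le> x a * ((S + 2) * C)"
        using queue_integral_diff_le[OF S] elim s by (auto simp: C_def S_def)
      then have "\<bar>err (x a) s\<bar> \<le> (S + 2) * C"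
        using elim by (simp add: err_def divide_le_eq mult_ac)
      then show ?case unfolding real_norm_def abs_mult by (rule mult_right_mono) simp
    qed
    show "((\<lambda>a. (S + 2) * C * \<bar>1 / den (x a) (t a) - 1 / den (x a) s\<bar>) \<longlongrightarrow> 0) F"
      by (intro tendsto_mult_right_zero tendsto_rabs_zero den)
  qed
  have "((\<lambda>a. (err (x a) (t a) - err (x a) s) * (1 / den (x a) (t a))
             + err (x a) s * (1 / den (x a) (t a) - 1 / den (x a) s)) \<longlongrightarrow> 0 * (1 / den 0 s) + 0) F"
    by (intro tendsto_add tendsto_mult err_diff dent err_den)
  moreover have "eventually (\<lambda>a. scaled_error (x a) s - scaled_error (x a) (t a)
      = (err (x a) (t a) - err (x a) s) * (1 / den (x a) (t a))
             + err (x a) s * (1 / den (x a) (t a) - 1 / den (x a) s)) F"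
    using ev order_tendstoD(1)[OF Jt J0] order_tendstoD(1)[OF Js J0] order_tendstoD(1)[OF J0t J0]
  proof eventually_elim
    case (elim a)
    have eq: "scaled_error (x a) r = - (err (x a) r / den (x a) r)"
      if "r > 0" "queue_integral (x a) r > 0" "queue_integral 0 r > 0" for r
      using that elim(1) by (simp add: scaled_error_def err_def den_def field_simps)
    show ?case using elim s J0 by (simp add: eq algebra_simps)
  qed
  ultimately show ?thesis by (simp add: tendsto_cong)
qed

theorem proposition2:
  fixes \<mu> :: real
    and q :: "real \<Rightarrow> real"
    and \<epsilon> :: "real \<Rightarrow> real \<Rightarrow> real"
    and \<sigma> :: real
    and \<delta> :: "real \<Rightarrow> real"
  assumes "\<mu> > 0"
    and "\<And>lam s. lam > 0 \<Longrightarrow> s > 0 \<Longrightarrow>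
           mean_queue \<mu> lam (lam / \<mu> + s * sqrt (lam / \<mu>)) = q s * sqrt (lam / \<mu>) + \<epsilon> lam s"
    and "times_continuously_differentiable_on 3 q {0<..}"
    and "\<And>s. s > 0 \<Longrightarrow> q s \<ge> 0"
    and "\<And>s. s > 0 \<Longrightarrow> (\<lambda>lam. \<epsilon> lam s) \<in> O[at_top](\<lambda>_. 1)"
    and "\<sigma> > 0"
    and "\<delta> \<in> O[at_top](\<lambda>lam. lam powr (1/4))"
  shows "((\<lambda>lam. \<bar>\<epsilon> lam \<sigma> - \<epsilon> lam (\<sigma> + \<delta> lam / sqrt (lam / \<mu>))\<bar>) \<longlongrightarrow> 0) at_top"
proof -
  define x where "x lam = 1 / sqrt (lam / \<mu>)" for lam :: real
  have x0: "(x \<longlongrightarrow> 0) at_top" unfolding x_def using assms(1) by real_asymp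
  have x_pos: "eventually (\<lambda>lam. x lam > 0) at_top"
    using eventually_gt_at_top[of 0] by eventually_elim (use assms(1) in \<open>simp add: x_def\<close>)
  have queue: "q s + \<epsilon> lam s * x lam = 1 / (s * queue_integral (x lam) s)"
    if "lam > 0" "s > 0" for lam s
  proof -
    have root: "sqrt (lam / \<mu>) > 0" using that assms(1) by simp
    have "q s + \<epsilon> lam s * x lam
            = mean_queue \<mu> lam (lam / \<mu> + s * sqrt (lam / \<mu>)) / sqrt (lam / \<mu>)"
      unfolding assms(2)[OF that] using root that assms(1) by (simp add: x_def add_divide_distrib)
    also have "\<dots> = 1 / (s * queue_integral (x lam) s)"
      unfolding mean_queue_eq_queue_integral[OF assms(1) that] using root that assms(1)
      by (simp add: x_def)
    finally show ?thesis .
  qed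
  \<comment> \<open>The expansion determines its own leading coefficient, as the limit of the scaled queue length.\<close>
  have q: "q s = 1 / (s * queue_integral 0 s)" if s: "s > 0" for s
  proof (rule tendsto_unique[OF trivial_limit_at_top_linorder])
    have J0: "queue_integral 0 s > 0" using queue_integral_limit_pos[of s] s by simp
    have "((\<lambda>lam. queue_integral (x lam) s) \<longlongrightarrow> queue_integral 0 s) at_top"
      using x_pos by (intro queue_integral_tendsto[OF x0 _ tendsto_const s])
        (auto elim: eventually_mono)
    then have "((\<lambda>lam. 1 / (s * queue_integral (x lam) s))
                 \<longlongrightarrow> 1 / (s * queue_integral 0 s)) at_top"
      using s J0 by (intro tendsto_intros) auto
    moreover have "eventually (\<lambda>lam. 1 / (s * queue_integral (x lam) s) = q s + \<epsilon> lam s * x lam) at_top"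
      using eventually_gt_at_top[of 0] by eventually_elim (simp add: queue s)
    ultimately show "((\<lambda>lam. q s + \<epsilon> lam s * x lam) \<longlongrightarrow> 1 / (s * queue_integral 0 s)) at_top"
      by (simp add: tendsto_cong)
    obtain c where c: "eventually (\<lambda>lam. norm (\<epsilon> lam s) \<le> c * norm (1::real)) at_top"
      using landau_o.bigE[OF assms(5)[OF s]] by metis
    have "((\<lambda>lam. \<epsilon> lam s * x lam) \<longlongrightarrow> 0) at_top"
    proof (rule Lim_null_comparison)
      show "eventually (\<lambda>lam. norm (\<epsilon> lam s * x lam) \<le> c * \<bar>x lam\<bar>) at_top"
        using c by eventually_elim (simp add: abs_mult mult_right_mono)
      show "((\<lambda>lam. c * \<bar>x lam\<bar>) \<longlongrightarrow> 0) at_top"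
        by (intro tendsto_mult_right_zero tendsto_rabs_zero x0)
    qed
    then show "((\<lambda>lam. q s + \<epsilon> lam s * x lam) \<longlongrightarrow> q s) at_top"
      using tendsto_add[OF tendsto_const[of "q s"]] by fastforce
  qed
  have eps: "\<epsilon> lam s = scaled_error (x lam) s" if "lam > 0" "s > 0" for lam s
  proof -
    have "x lam \<noteq> 0" using that assms(1) by (simp add: x_def)
    then show ?thesis
      using queue[OF that] q[OF that(2)] by (simp add: scaled_error_def field_simps)
  qed
  define t where "t lam = \<sigma> + \<delta> lam / sqrt (lam / \<mu>)" for lam
  have "(\<lambda>lam::real. lam powr (1/4)) \<in> o[at_top](\<lambda>lam. sqrt (lam / \<mu>))"
    using assms(1) by real_asymp
  then have "((\<lambda>lam. \<delta> lam / sqrt (lam / \<mu>)) \<longlongrightarrow> 0) at_top"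
    by (intro smalloD_tendsto landau_o.big_small_trans[OF assms(7)])
  from tendsto_add[OF tendsto_const[of \<sigma>] this] have t: "(t \<longlongrightarrow> \<sigma>) at_top"
    by (simp add: t_def[abs_def])
  have "((\<lambda>lam. \<bar>scaled_error (x lam) \<sigma> - scaled_error (x lam) (t lam)\<bar>) \<longlongrightarrow> 0) at_top"
    by (intro tendsto_rabs_zero scaled_error_increment_tendsto_0 x0 x_pos t assms(6))
  moreover have "eventually (\<lambda>lam. \<bar>scaled_error (x lam) \<sigma> - scaled_error (x lam) (t lam)\<bar>
                   = \<bar>\<epsilon> lam \<sigma> - \<epsilon> lam (t lam)\<bar>) at_top"
    using eventually_gt_at_top[of 0] order_tendstoD(1)[OF t assms(6)]
    by eventually_elim (simp add: eps assms(6))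
  ultimately show ?thesis unfolding t_def[symmetric] by (simp add: tendsto_cong)
qed

end
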